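(* There are infinitely many triangular numbers which are quotients of tetrahedral numbers; i.e., there are infinitely many positive integers $z$ (giving infinitely many distinct values $t_z$) such that $t_z = \frac{T_y}{T_x}$ for some positive integers $x, y$.
   Context: $t_n = \frac{n(n+1)}{2}$ is the $n$-th triangular number and $T_n = \frac{n(n+1)(n+2)}{6}$ is the $n$-th tetrahedral number. *)

theory Defs
  imports Complex_Main
begin

text \<open>Both numbers are taken in \<^typ>\<open>rat\<close>, so that every division below,
  including the quotient of two tetrahedral numbers, is exact field division.\<close>

definition triangular :: "nat \<Rightarrow> rat" where
  "triangular n = of_nat (n * (n + 1)) / 2"

definition tetrahedral :: "nat \<Rightarrow> rat" where
  "tetrahedral n = of_nat (n * (n + 1) * (n + 2)) / 6"

end

theory Submission
  imports Defs "HOL-Library.Infinite_Set"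
begin

text \<open>For \<open>y = 3 T\<^sub>x\<close> the factor \<open>y\<close> of \<open>6 T\<^sub>y = y (y + 1) (y + 2)\<close> is cancelled by \<open>T\<^sub>x\<close>,
  and what remains is \<open>T\<^sub>y / T\<^sub>x = (y + 1) (y + 2) / 2 = t\<^bsub>y+1\<^esub>\<close>.\<close>

lemma triangular_Suc_eq_tetrahedral_quotient:
  assumes "x > 0" and "of_nat y = 3 * tetrahedral x"
  shows "triangular (Suc y) = tetrahedral y / tetrahedral x"
proof -
  have "tetrahedral x \<noteq> 0"
    \<comment> \<open>Left inside one \<open>of_nat\<close>, the product is nonzero because its
      natural factors are positive.\<close>
    using assms(1) unfolding tetrahedral_def by (simp del: of_nat_mult of_nat_add)
  moreover have "tetrahedral y = of_nat y / 3 * triangular (Suc y)"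
    unfolding tetrahedral_def triangular_def by (simp add: algebra_simps)
  ultimately show ?thesis
    using assms(2) by simp
qed

text \<open>Since \<open>n * (n + 1)\<close> is strictly increasing on naturals, infinitely many
  indices give infinitely many values.\<close>

lemma inj_triangular: "inj triangular"
proof (rule injI)
  fix m n :: nat
  assume "triangular m = triangular n"
  then have "of_nat (m * (m + 1)) = (of_nat (n * (n + 1)) :: rat)"
    unfolding triangular_def by simp
  then have eq: "m * (m + 1) = n * (n + 1)"
    by (simp only: of_nat_eq_iff)
  show "m = n"
  proof (rule linorder_cases[of m n])
    assume "m < n"
    then have "m * (m + 1) < n * (n + 1)" by (intro mult_strict_mono) auto
    with eq show ?thesis by simp
  next
    assume "n < m"
    then have "n * (n + 1) < m * (m + 1)" by (intro mult_strict_mono) auto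
    with eq show ?thesis by simp
  qed simp
qed

theorem theorem5p1:
  "infinite {z :: nat. z > 0 \<and>
      (\<exists>x y :: nat. x > 0 \<and> y > 0 \<and> triangular z = tetrahedral y / tetrahedral x)} \<and>
   infinite {t :: rat. \<exists>z x y :: nat. z > 0 \<and> x > 0 \<and> y > 0 \<and>
      t = triangular z \<and> t = tetrahedral y / tetrahedral x}"
  (is "infinite ?Z \<and> infinite ?T")
proof
  show inf: "infinite ?Z"
    unfolding infinite_nat_iff_unbounded
  proof
    fix m :: nat
    \<comment> \<open>An even \<open>x = 2 n\<close> makes \<open>3 T\<^sub>x = x (x + 1) (x + 2) / 2\<close> a polynomial in \<open>n\<close>.\<close>
    define n where "n = Suc m"
    define y where "y = 2 * n * (2 * n + 1) * (n + 1)"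
    have "of_nat y = 3 * tetrahedral (2 * n)"
      unfolding y_def tetrahedral_def by (simp add: field_simps)
    then have "triangular (Suc y) = tetrahedral y / tetrahedral (2 * n)"
      by (intro triangular_Suc_eq_tetrahedral_quotient) (simp_all add: n_def)
    \<comment> \<open>Taking \<open>n = Suc m\<close> keeps \<open>n\<close> positive even for
      \<open>m = 0\<close>; as a positive multiple of \<open>n\<close>, \<open>y\<close> exceeds
      \<open>m\<close>.\<close>
    moreover have "2 * n > 0" "y > 0" "m < Suc y"
      unfolding y_def n_def by simp_all
    ultimately show "\<exists>z>m. z \<in> ?Z" by blast
  qed
  have "infinite (triangular ` ?Z)"
    using inf inj_on_subset[OF inj_triangular subset_UNIV] by (simp only: finite_image_iff not_False_eq_True)
  moreover have "triangular ` ?Z \<subseteq> ?T" by blast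
  ultimately show "infinite ?T" by (rule infinite_super[rotated])
qed

end
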